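(* Let $\mathbb{F}$ be a field of characteristic zero, let $Q:\mathbb{F}[t]\to\mathbb{F}[t]$ be a delta operator with basic set $q=(q_n(t))_{n\ge0}$, and write $Q=p(\delta)$ with $p$ a formal power series. Suppose $f(x)=\prod_{k=1}^n(a_kx+b_k)$ is a separable polynomial in $\mathbb{F}[x]\subset H_{\mathbb{F}}[[x]]$ with $a_k,b_k\in\mathbb{F}$ and all $a_k\ne0$. Then $$\rho_q\mathfrak{A}(\Delta f(x))=\rho_1\circledast_q\rho_2\circledast_q\cdots\circledast_q\rho_n,\qquad \rho_k=\frac{1}{a_k}(a_kx+b_k)\left(e^{t\,p^{-1}(a_k)}-1\right),$$ where $p^{-1}$ is the compositional inverse formal power series of $p$.
   Context: $H_{\mathbb{F}}[[x]]$ is the ring of Hurwitz series $\sum_{n\ge0}a_n x^n/n!$ with $a_n\in\mathbb{F}$, and $\delta$ denotes the derivative (in $x$ on $H_{\mathbb{F}}[[x]]$, in $t$ on $\mathbb{F}[t]$). For $f\in H_{\mathbb{F}}[[x]]$, $\Delta f=(f,\delta f,\delta^2 f,\dots)$. The autonomous polynomials are $A_1(f)=f$ and $A_{n+1}(f)=\sum_{k=1}^n B_{n,k}(A_1(f),A_2(f),\dots)\,\delta^k f$ for $n\ge1$, with $B_{n,k}$ the partial exponential Bell polynomials; $\mathfrak{A}(\Delta f)=(A_n(f))_{n\ge1}$. A delta operator on $\mathbb{F}[t]$ is a linear operator $Q$ commuting with all shifts $p(t)\mapsto p(t+a)$, $a\in\mathbb{F}$, with $Qt$ a nonzero constant; it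 has an expansion $Q=p(\delta)$ with $p$ a formal power series, $p(0)=0$, $p'(0)\ne0$. Its basic set $(q_n(t))_{n\ge0}$ is the polynomial sequence, $\deg q_n=n$, with $q_0=1$, $q_n(0)=0$ for $n\ge1$, and $Qq_n=n\,q_{n-1}$. Define $\rho_q\mathfrak{A}(\Delta f)=\sum_{n\ge1}A_n(f)\,q_n(t)/n!$, a formal series in the polynomials $q_n(t)$. On the set of all series $\rho_q\mathfrak{A}(\Delta f)$, $f\in H_{\mathbb{F}}[[x]]$, the product $\circledast_q$ is given by $\rho_q\mathfrak{A}(\Delta f)\circledast_q\rho_q\mathfrak{A}(\Delta g)=\rho_q\mathfrak{A}(\Delta(fg))=\sum_{n\ge1}A_n(fg)\,q_n(t)/n!$; this is well defined because $f=A_1(f)$ is the coefficient of $q_1(t)$. The generating function identity $\sum_{n\ge0}q_n(t)u^n/n!=e^{t\,p^{-1}(u)}$ holds for the basic set, and for $a\in\mathbb{F}$, $e^{t\,p^{-1}(a)}$ denotes the formal series $\sum_{n\ge0}a^n q_n(t)/n!$. *)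

theory Defs
  imports "HOL-Computational_Algebra.Computational_Algebra"
begin

text \<open>
  Over a field of characteristic zero every formal power series is a Hurwitz series
  (the coefficient of \<open>x\<^sup>n / n!\<close> is \<open>n!\<close> times the coefficient of \<open>x\<^sup>n\<close>), so the ring of
  Hurwitz series is the type \<open>'a fps\<close>, with derivation \<^const>\<open>fps_deriv\<close>.
\<close>

subsection \<open>Autonomous polynomials\<close>

text \<open>
  The index set consists of the exponent vectors \<open>(j\<^sub>1, \<dots>, j\<^sub>m)\<close>, \<open>m = n - k + 1\<close>, with
  \<open>\<Sum> j\<^sub>i = k\<close> and \<open>\<Sum> i j\<^sub>i = n\<close>, extended by zero; it is finite.
  The formula is used for \<open>1 \<le> k \<le> n\<close> only.
\<close>

definition Bell :: "nat \<Rightarrow> nat \<Rightarrow> (nat \<Rightarrow> 'a::field_char_0 fps) \<Rightarrow> 'a fps" where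
  "Bell n k X =
     (\<Sum>j\<in>{j. (\<forall>i. i \<notin> {1..n - k + 1} \<longrightarrow> j i = 0) \<and>
              (\<Sum>i=1..n - k + 1. j i) = k \<and> (\<Sum>i=1..n - k + 1. i * j i) = n}.
        fps_const (fact n / (\<Prod>i=1..n - k + 1. fact (j i) * fact i ^ j i)) *
        (\<Prod>i=1..n - k + 1. X i ^ j i))"

text \<open>
  The autonomous polynomials are indexed from 1; index 0 is a dummy. The test \<open>i \<le> Suc n\<close> serves
  only the termination proof, see \<open>autonomous_rec\<close> below.
\<close>

fun autonomous :: "'a::field_char_0 fps \<Rightarrow> nat \<Rightarrow> 'a fps" where
  "autonomous f 0 = 0"
| "autonomous f (Suc 0) = f"
| "autonomous f (Suc (Suc n)) =
     (\<Sum>k=1..Suc n. Bell (Suc n) k (\<lambda>i. if i \<le> Suc n then autonomous f i else 0) *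
        (fps_deriv ^^ k) f)"

lemma finite_Bell_index:
  "finite {j :: nat \<Rightarrow> nat. (\<forall>i. i \<notin> {1..m} \<longrightarrow> j i = 0) \<and> (\<Sum>i=1..m. j i) = k \<and>
     (\<Sum>i=1..m. i * j i) = n}"
proof (rule finite_subset)
  show "finite {j. \<forall>i. (i \<in> {1..m} \<longrightarrow> j i \<in> {..k}) \<and> (i \<notin> {1..m} \<longrightarrow> j i = (0::nat))}"
    by (rule finite_set_of_finite_funs) auto
  show "{j :: nat \<Rightarrow> nat. (\<forall>i. i \<notin> {1..m} \<longrightarrow> j i = 0) \<and> (\<Sum>i=1..m. j i) = k \<and>
      (\<Sum>i=1..m. i * j i) = n} \<subseteq>
    {j. \<forall>i. (i \<in> {1..m} \<longrightarrow> j i \<in> {..k}) \<and> (i \<notin> {1..m} \<longrightarrow> j i = (0::nat))}"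
  proof
    fix j :: "nat \<Rightarrow> nat"
    assume j: "j \<in> {j. (\<forall>i. i \<notin> {1..m} \<longrightarrow> j i = 0) \<and> (\<Sum>i=1..m. j i) = k \<and>
      (\<Sum>i=1..m. i * j i) = n}"
    have "j i \<le> k" if "i \<in> {1..m}" for i
      using member_le_sum[OF that, of j] j by simp
    thus "j \<in> {j. \<forall>i. (i \<in> {1..m} \<longrightarrow> j i \<in> {..k}) \<and> (i \<notin> {1..m} \<longrightarrow> j i = (0::nat))}"
      using j by simp
  qed
qed

lemma Bell_cong:
  assumes "\<And>i. 1 \<le> i \<Longrightarrow> i \<le> n - k + 1 \<Longrightarrow> X i = Y i"
  shows "Bell n k X = Bell n k Y"
  unfolding Bell_def by (intro sum.cong prod.cong arg_cong2[of _ _ _ _ "(*)"] refl) (simp add: assms)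

lemma autonomous_rec:
  assumes "n \<ge> 1"
  shows "autonomous f (Suc n) = (\<Sum>k=1..n. Bell n k (autonomous f) * (fps_deriv ^^ k) f)"
proof -
  obtain m where n: "n = Suc m" using assms by (cases n) auto
  show ?thesis unfolding n autonomous.simps
    by (intro sum.cong arg_cong2[of _ _ _ _ "(*)"] Bell_cong refl) auto
qed


subsection \<open>Delta operators and basic sets\<close>

definition delta_operator :: "('a::field_char_0 poly \<Rightarrow> 'a poly) \<Rightarrow> bool" where
  "delta_operator Q \<longleftrightarrow>
     Vector_Spaces.linear smult smult Q \<and>
     (\<forall>a r. Q (r \<circ>\<^sub>p [:a, 1:]) = Q r \<circ>\<^sub>p [:a, 1:]) \<and>
     (\<exists>c. c \<noteq> 0 \<and> Q [:0, 1:] = [:c:])"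

definition basic_set :: "('a::field_char_0 poly \<Rightarrow> 'a poly) \<Rightarrow> (nat \<Rightarrow> 'a poly) \<Rightarrow> bool" where
  "basic_set Q q \<longleftrightarrow>
     (\<forall>n. degree (q n) = n) \<and> q 0 = 1 \<and> (\<forall>n\<ge>1. poly (q n) 0 = 0) \<and>
     (\<forall>n\<ge>1. Q (q n) = smult (of_nat n) (q (n - 1)))"

text \<open>
  The operator \<open>p(\<delta>)\<close>; the sum can be truncated because higher derivatives vanish.
\<close>

definition pderiv_series :: "'a::field_char_0 fps \<Rightarrow> 'a poly \<Rightarrow> 'a poly" where
  "pderiv_series p r = (\<Sum>k\<le>degree r. smult (fps_nth p k) ((pderiv ^^ k) r))"


subsection \<open>Formal series in the polynomials of a basic set\<close>

text \<open>
  Such a series \<open>\<Sum> c\<^sub>n q\<^sub>n(t)\<close> with Hurwitz series \<open>c\<^sub>n\<close> is in general not a formal power series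
  in \<open>t\<close>. It is represented by the sequence of its terms \<open>c\<^sub>n q\<^sub>n(t)\<close>, which are polynomials in \<open>t\<close>
  over the ring of Hurwitz series, and this sequence is stored as an \<open>fps\<close> whose variable merely
  marks the index \<open>n\<close>. As \<open>q\<^sub>n \<noteq> 0\<close>, the terms determine the coefficients \<open>c\<^sub>n\<close>. Addition of
  \<open>fps\<close>, multiplication by constants from \<open>'a fps\<close>, and \<open>1\<close> (the term \<open>q\<^sub>0 = 1\<close>) are those
  of formal series in the \<open>q\<^sub>n\<close>.
\<close>

type_synonym 'a qseries = "'a fps poly fps"

definition rho :: "(nat \<Rightarrow> 'a::field_char_0 poly) \<Rightarrow> (nat \<Rightarrow> 'a fps) \<Rightarrow> 'a qseries" where
  "rho q A = Abs_fps (\<lambda>n. if n = 0 then 0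
     else smult (A n * fps_const (1 / fact n)) (map_poly fps_const (q n)))"

text \<open>
  The product is meaningful only on the range of \<open>\<lambda>f. rho q (autonomous f)\<close>;
  see \<open>star_rho\<close> below.
\<close>

definition star :: "(nat \<Rightarrow> 'a::field_char_0 poly) \<Rightarrow> 'a qseries \<Rightarrow> 'a qseries \<Rightarrow> 'a qseries" where
  "star q R S = rho q (autonomous
     ((THE f. R = rho q (autonomous f)) * (THE g. S = rho q (autonomous g))))"

text \<open>The series \<open>e\<^bsup>t s(u)\<^esup>\<close> in \<open>u\<close>, for \<open>s(0) = 0\<close>.\<close>

definition exp_gen :: "'a::field_char_0 fps \<Rightarrow> 'a poly fps" where
  "exp_gen s = Abs_fps (\<lambda>k. monom (1 / fact k) k) oo Abs_fps (\<lambda>n. [:fps_nth s n:])"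

text \<open>
  The formal series \<open>e\<^bsup>t s(a)\<^esup>\<close>, i.e. \<open>u\<close> is specialised to \<open>a\<close> termwise in \<open>e\<^bsup>t s(u)\<^esup>\<close>.
  By \<open>exp_series_basic_set\<close> below, for \<open>s = p\<^sup>-\<^sup>1\<close> this is \<open>\<Sum> a\<^sup>n q\<^sub>n(t) / n!\<close>.
\<close>

definition exp_series :: "'a::field_char_0 fps \<Rightarrow> 'a \<Rightarrow> 'a qseries" where
  "exp_series s a = Abs_fps (\<lambda>n. map_poly fps_const (smult (a ^ n) (fps_nth (exp_gen s) n)))"


subsection \<open>Consistency of the definitions\<close>

lemma rho_autonomous_inj:
  assumes "q 1 \<noteq> 0" "rho q (autonomous f) = rho q (autonomous g)"
  shows "f = g"
proof -
  have "rho q (autonomous f) $ 1 = rho q (autonomous g) $ 1" using assms(2) by simp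
  hence *: "smult f (map_poly fps_const (q 1)) = smult g (map_poly fps_const (q 1))"
    by (simp add: rho_def)
  have "f * fps_const (lead_coeff (q 1)) = g * fps_const (lead_coeff (q 1))"
    using arg_cong[OF *, of "\<lambda>r. coeff r (degree (q 1))"] by (simp add: coeff_map_poly)
  thus ?thesis using assms(1) by simp
qed

lemma star_rho:
  assumes "q 1 \<noteq> 0"
  shows "star q (rho q (autonomous f)) (rho q (autonomous g)) = rho q (autonomous (f * g))"
proof -
  have "(THE h. rho q (autonomous f) = rho q (autonomous h)) = f" for f
    using rho_autonomous_inj[of q] assms by (intro the_equality) blast+
  thus ?thesis by (simp add: star_def)
qed

lemma coeff_pderiv_funpow:
  "coeff ((pderiv ^^ k) r) j = (fact (j + k) / fact j) * coeff (r :: 'a::field_char_0 poly) (j + k)"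
proof (induction k arbitrary: j)
  case (Suc k)
  have f: "(fact (Suc j) :: 'a) = of_nat (Suc j) * fact j" by (rule fact_Suc)
  have "coeff ((pderiv ^^ Suc k) r) j =
      of_nat (Suc j) * ((fact (Suc j + k) / fact (Suc j)) * coeff r (Suc j + k))"
    by (simp only: funpow.simps o_def coeff_pderiv Suc)
  also have "\<dots> = (fact (Suc j + k) / fact j) * coeff r (Suc j + k)"
    unfolding f by (simp del: of_nat_Suc fact_Suc)
  finally show ?case by simp
qed simp

lemma coeff_pderiv_series:
  "coeff (pderiv_series p r) j =
     (\<Sum>k\<le>degree r. fps_nth p k * (fact (j + k) / fact j * coeff r (j + k)))"
  by (simp add: pderiv_series_def coeff_sum coeff_pderiv_funpow)

lemma coeff_pderiv_series':
  assumes "degree r \<le> N"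
  shows "coeff (pderiv_series p r) j =
     (\<Sum>k\<le>N. fps_nth p k * (fact (j + k) / fact j * coeff r (j + k)))"
  unfolding coeff_pderiv_series using assms
  by (intro sum.mono_neutral_left) (auto simp: coeff_eq_0)

lemma const_fps_power:
  "(Abs_fps (\<lambda>n. [:fps_nth s n:])) ^ k $ n = [:(s ^ k) $ n:]"
  for s :: "'a::field_char_0 fps"
proof (induction k arbitrary: n)
  case 0
  show ?case by (cases n) (auto simp: one_pCons)
next
  case (Suc k)
  have sp: "(\<Sum>i\<in>A. [:h i:]) = [:\<Sum>i\<in>A. h i:]" for h :: "nat \<Rightarrow> 'a" and A
    by (induction A rule: infinite_finite_induct) auto
  show ?case by (simp add: fps_mult_nth Suc sp mult.commute)
qed

lemma coeff_exp_gen: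
  assumes "s $ 0 = 0"
  shows "coeff (exp_gen s $ n) j = (s ^ j) $ n / fact j"
proof -
  have "coeff (exp_gen s $ n) j = (\<Sum>i = 0..n. if i = j then (s ^ j) $ n / fact j else 0)"
    unfolding exp_gen_def fps_compose_nth const_fps_power fps_nth_Abs_fps coeff_sum
    by (intro sum.cong) (auto simp: mult.commute[of _ "[:_:]"])
  also have "\<dots> = (s ^ j) $ n / fact j"
    using startsby_zero_power_prefix[OF assms, of j] by (auto simp: sum.delta)
  finally show ?thesis .
qed

lemma pderiv_series_exp_gen:
  assumes p: "p $ 0 = 0" "p $ 1 \<noteq> 0"
  shows "pderiv_series p (exp_gen (fps_inv p) $ Suc n) = exp_gen (fps_inv p) $ n"
proof (rule poly_eqI)
  fix j
  let ?s = "fps_inv p"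
  have s0: "?s $ 0 = 0" by (simp add: fps_inv_def)
  have deg: "degree (exp_gen ?s $ Suc n) \<le> Suc n"
    using startsby_zero_power_prefix[OF s0] by (intro degree_le) (auto simp: coeff_exp_gen[OF s0])
  have fact_eq: "(fact (j + k) / fact j * ((?s ^ (j + k)) $ Suc n / fact (j + k))) =
    (?s ^ k * ?s ^ j) $ Suc n / fact j" for k
    by (simp add: power_add mult.commute)
  have "coeff (pderiv_series p (exp_gen ?s $ Suc n)) j =
     (\<Sum>k\<le>Suc n. p $ k * ((?s ^ k * ?s ^ j) $ Suc n / fact j))"
    unfolding coeff_pderiv_series'[OF deg] coeff_exp_gen[OF s0] fact_eq ..
  also have "\<dots> = (\<Sum>k\<le>Suc n. p $ k * (?s ^ k * ?s ^ j) $ Suc n) / fact j"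
    by (simp add: sum_divide_distrib del: sum.atMost_Suc)
  also have "(\<Sum>k\<le>Suc n. p $ k * (?s ^ k * ?s ^ j) $ Suc n) = ((p oo ?s) * ?s ^ j) $ Suc n"
  proof -
    have "((p oo ?s) * ?s ^ j) $ Suc n =
        (\<Sum>i=0..Suc n. (\<Sum>k=0..i. p $ k * (?s ^ k) $ i) * (?s ^ j) $ (Suc n - i))"
      by (simp add: fps_mult_nth fps_compose_nth)
    also have "\<dots> = (\<Sum>i=0..Suc n. (\<Sum>k=0..Suc n. p $ k * (?s ^ k) $ i) * (?s ^ j) $ (Suc n - i))"
      using startsby_zero_power_prefix[OF s0]
      by (intro sum.cong arg_cong2[of _ _ _ _ "(*)"] sum.mono_neutral_left) auto
    also have "\<dots> = (\<Sum>k=0..Suc n. \<Sum>i=0..Suc n. p $ k * (?s ^ k) $ i * (?s ^ j) $ (Suc n - i))"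
      unfolding sum_distrib_right by (rule sum.swap)
    also have "\<dots> = (\<Sum>k\<le>Suc n. p $ k * (?s ^ k * ?s ^ j) $ Suc n)"
      by (simp only: fps_mult_nth sum_distrib_left mult.assoc atMost_atLeast0)
    finally show ?thesis ..
  qed
  also have "p oo ?s = fps_X" using fps_inv_right[OF p] .
  finally show "coeff (pderiv_series p (exp_gen ?s $ Suc n)) j = coeff (exp_gen ?s $ n) j"
    by (simp add: coeff_exp_gen[OF s0])
qed

lemma delta_operator_series:
  assumes "delta_operator Q" "Q = pderiv_series p"
  shows "p $ 0 = 0" "p $ 1 \<noteq> 0"
proof -
  obtain c where c: "c \<noteq> 0" "pderiv_series p [:0, 1:] = [:c:]"
    using assms by (auto simp: delta_operator_def)
  have "coeff (pderiv_series p [:0, 1:]) 1 = p $ 0" "coeff (pderiv_series p [:0, 1:]) 0 = p $ 1"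
    by (simp_all add: coeff_pderiv_series)
  thus "p $ 0 = 0" "p $ 1 \<noteq> 0" using c by simp_all
qed

lemma pderiv_series_eqD:
  assumes p: "p $ 0 = 0" "p $ 1 \<noteq> 0"
    and eq: "pderiv_series p r = pderiv_series p s" "poly r 0 = poly s 0"
  shows "r = s"
proof -
  define d where "d = r - s"
  define N where "N = max (degree r) (degree s)"
  have degr: "degree r \<le> N" and degs: "degree s \<le> N" by (simp_all add: N_def)
  hence degd: "degree d \<le> N" unfolding d_def by (rule degree_diff_le)
  have "coeff (pderiv_series p d) j = coeff (pderiv_series p r) j - coeff (pderiv_series p s) j" for j
    unfolding coeff_pderiv_series'[OF degr] coeff_pderiv_series'[OF degs] coeff_pderiv_series'[OF degd]
    by (simp add: d_def sum_subtractf[symmetric] algebra_simps)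
  hence z: "coeff (pderiv_series p d) j = 0" for j using eq by simp
  have "degree d = 0"
  proof (rule ccontr)
    assume "degree d \<noteq> 0"
    then obtain m where m: "degree d = Suc m" by (cases "degree d") auto
    have "coeff (pderiv_series p d) m =
        (\<Sum>k\<in>{..Suc m}. if k = 1 then p $ 1 * (fact (Suc m) / fact m * coeff d (Suc m)) else 0)"
      unfolding coeff_pderiv_series m
    proof (intro sum.cong refl)
      fix k assume "k \<in> {..Suc m}"
      show "p $ k * (fact (m + k) / fact m * coeff d (m + k)) =
         (if k = 1 then p $ 1 * (fact (Suc m) / fact m * coeff d (Suc m)) else 0)"
        using p m by (cases "k = 0"; cases "k = 1") (auto simp: coeff_eq_0)
    qed
    also have "\<dots> = p $ 1 * (fact (Suc m) / fact m * coeff d (Suc m))" by simp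
    finally have "coeff d (Suc m) = 0" using z[of m] p by (simp del: fact_Suc)
    hence "d = 0" using m by (metis leading_coeff_0_iff)
    thus False using m by simp
  qed
  moreover have "coeff d 0 = 0" using eq(2) by (simp add: d_def poly_0_coeff_0)
  ultimately have "d = 0" by (metis leading_coeff_0_iff)
  thus ?thesis by (simp add: d_def)
qed

lemma exp_gen_basic_set:
  assumes Q: "delta_operator Q" "Q = pderiv_series p" and q: "basic_set Q q"
  shows "exp_gen (fps_inv p) $ n = smult (1 / fact n) (q n)"
proof (induction n)
  case 0
  have s0: "fps_inv p $ 0 = 0" by (simp add: fps_inv_def)
  show ?case using q
    by (intro poly_eqI) (auto simp: coeff_exp_gen[OF s0] basic_set_def coeff_pCons power_0_left fps_power_zeroth s0
         split: nat.splits)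
next
  case (Suc n)
  note p = delta_operator_series[OF Q]
  have s0: "fps_inv p $ 0 = 0" by (simp add: fps_inv_def)
  have lin: "module_hom smult smult Q"
    using Q(1) by (simp add: delta_operator_def Vector_Spaces.linear_def)
  have "Q (smult (1 / fact (Suc n)) (q (Suc n))) = smult (1 / fact n) (q n)"
  proof -
    have "Q (q (Suc n)) = smult (of_nat (Suc n)) (q n)" using q by (simp add: basic_set_def)
    thus ?thesis by (simp add: module_hom.scale[OF lin] del: of_nat_Suc)
  qed
  also have "\<dots> = Q (exp_gen (fps_inv p) $ Suc n)"
    using pderiv_series_exp_gen[OF p] Suc Q(2) by simp
  finally have "pderiv_series p (exp_gen (fps_inv p) $ Suc n) =
      pderiv_series p (smult (1 / fact (Suc n)) (q (Suc n)))"
    unfolding Q(2) by (rule sym)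
  moreover have "poly (exp_gen (fps_inv p) $ Suc n) 0 = poly (smult (1 / fact (Suc n)) (q (Suc n))) 0"
    using q by (simp add: poly_0_coeff_0 coeff_exp_gen[OF s0] basic_set_def del: fact_Suc)
  ultimately show ?case by (rule pderiv_series_eqD[OF p])
qed

lemma exp_series_basic_set:
  assumes "delta_operator Q" "Q = pderiv_series p" "basic_set Q q"
  shows "exp_series (fps_inv p) a =
    Abs_fps (\<lambda>n. smult (fps_const (a ^ n / fact n)) (map_poly fps_const (q n)))"
  unfolding exp_series_def exp_gen_basic_set[OF assms]
  by (intro arg_cong[of _ _ Abs_fps] ext poly_eqI) (simp add: coeff_map_poly)

end

theory Submission
  imports Defs
begin

text \<open>
  For a linear \<open>f = a x + b\<close> only \<open>\<delta> f = a\<close> survives in the recursion, so \<open>A\<^sub>n(f) = a\<^sup>n\<^sup>-\<^sup>1 f\<close>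
  and the series of \<open>f\<close> is \<open>(1/a) f (e\<^bsup>t s(a)\<^esup> - 1)\<close>, where \<open>s = p\<^sup>-\<^sup>1\<close>. The product transports multiplication
  of the underlying functions.
\<close>

text \<open>An exponent vector of total 1 is a unit vector, and weight \<open>n\<close> puts its 1
  at position \<open>n\<close>. The single remaining coefficient is
  \<open>fact n / fact n = 1\<close>.\<close>

lemma Bell_one:
  assumes "n \<ge> 1"
  shows "Bell n 1 X = X n"
proof -
  define d where "d = (\<lambda>i. if i = n then 1 else 0 :: nat)"
  have index: "{j. (\<forall>i. i \<notin> {1..n} \<longrightarrow> j i = 0) \<and> (\<Sum>i=1..n. j i) = 1 \<and>
      (\<Sum>i=1..n. i * j i) = n} = {d}" (is "?J = _")
  proof (intro equalityI subsetI)
    fix j assume "j \<in> ?J"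
    hence zero: "\<And>i. i \<notin> {1..n} \<Longrightarrow> j i = 0" and one: "(\<Sum>i=1..n. j i) = 1"
      and weight: "(\<Sum>i=1..n. i * j i) = n" by auto
    obtain m where m: "m \<in> {1..n}" "j m = 1" "\<forall>i\<in>{1..n}. i \<noteq> m \<longrightarrow> j i = 0"
      using one sum_eq_1_iff[of "{1..n}" j] by auto
    have "(\<Sum>i=1..n. i * j i) = (\<Sum>i=1..n. if i = m then m else 0)"
      using m by (intro sum.cong) auto
    hence "m = n" using m(1) weight by simp
    hence "j i = d i" for i using m zero[of i] by (auto simp: d_def)
    thus "j \<in> {d}" by auto
  next
    fix j assume "j \<in> {d}"
    thus "j \<in> ?J" using assms by (auto simp: d_def if_distrib[of "(*) _"] cong: if_cong)
  qed
  have "(\<Prod>i=1..n. fact (d i) * fact i ^ d i) = (\<Prod>i=1..n. if i = n then fact n else 1 :: 'a)"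
    by (intro prod.cong) (auto simp: d_def)
  moreover have "(\<Prod>i=1..n. X i ^ d i) = (\<Prod>i=1..n. if i = n then X n else 1)"
    by (intro prod.cong) (auto simp: d_def)
  \<comment> \<open>The index bound \<open>n - k + 1\<close> of \<open>Bell_def\<close> at
    \<open>k = 1\<close>; truncated subtraction makes this fail for \<open>n = 0\<close>.\<close>
  moreover have "n - 1 + 1 = n" using assms by simp
  ultimately show ?thesis
    unfolding Bell_def using assms by (simp only: index) simp
qed

lemma autonomous_linear:
  "autonomous (fps_of_poly [:b, a:]) (Suc n) = fps_const (a ^ n) * fps_of_poly [:b, a:]"
proof (induction n)
  case (Suc n)
  let ?f = "fps_of_poly [:b, a:]"
  have deriv: "(fps_deriv ^^ k) ?f = (if k = 1 then fps_const a else 0)" if "k \<ge> 1" for k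
    using that
  proof (induction k rule: dec_induct)
    case base
    show ?case by (simp add: fps_of_poly_pderiv[symmetric] pderiv_pCons)
  next
    case (step k)
    thus ?case by simp
  qed
  have "autonomous ?f (Suc (Suc n)) =
      (\<Sum>k=1..Suc n. if k = 1 then Bell (Suc n) 1 (autonomous ?f) * fps_const a else 0)"
    \<comment> \<open>\<open>autonomous_rec\<close> gives \<open>Bell\<close> the whole sequence
      \<open>autonomous ?f\<close>, without the cutoff of the defining equation, so
      \<open>Bell_one\<close> then yields \<open>autonomous ?f (Suc n)\<close>.\<close>
    by (subst autonomous_rec, simp, intro sum.cong refl, subst deriv)
      (auto simp del: autonomous.simps funpow.simps)
  also have "\<dots> = autonomous ?f (Suc n) * fps_const a"
    by (simp add: Bell_one[unfolded One_nat_def] del: autonomous.simps)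
  finally show ?case by (simp only: Suc) (simp add: mult_ac fps_const_mult[symmetric] del: fps_const_mult)
qed simp

lemma rho_autonomous_linear:
  assumes "delta_operator Q" "Q = pderiv_series p" "basic_set Q q" and "a \<noteq> 0"
  shows "rho q (autonomous (fps_of_poly [:b, a:])) =
    fps_const [:fps_const (1 / a) * fps_of_poly [:b, a:]:] * (exp_series (fps_inv p) a - 1)"
proof (rule fps_ext)
  let ?f = "fps_of_poly [:b, a:]"
  fix n
  show "rho q (autonomous ?f) $ n =
    (fps_const [:fps_const (1 / a) * ?f:] * (exp_series (fps_inv p) a - 1)) $ n"
  proof (cases n)
    \<comment> \<open>Term 0 of the exponential series is \<open>q 0 = 1\<close>, which the
      subtracted 1 cancels; \<open>rho\<close> has no term there either.\<close>
    case 0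
    thus ?thesis
      using assms(3) by (simp add: rho_def exp_series_basic_set[OF assms(1-3)] basic_set_def)
  next
    case (Suc m)
    \<comment> \<open>The factor \<open>1 / a\<close> absorbs the shift between the exponent
      \<open>m\<close> in \<open>autonomous_linear\<close> and \<open>Suc m\<close> in the
      exponential series.\<close>
    have "fps_const (a ^ m) * fps_const (1 / fact (Suc m)) =
        fps_const (1 / a) * fps_const (a ^ Suc m / fact (Suc m))"
      using \<open>a \<noteq> 0\<close> by (simp del: fact_Suc)
    hence "?f * (fps_const (a ^ m) * fps_const (1 / fact (Suc m))) =
        ?f * (fps_const (1 / a) * fps_const (a ^ Suc m / fact (Suc m)))"
      by (rule arg_cong)
    hence "fps_const (a ^ m) * ?f * fps_const (1 / fact (Suc m)) =
        fps_const (a ^ Suc m / fact (Suc m)) * (fps_const (1 / a) * ?f)"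
      by (simp only: mult_ac)
    thus ?thesis
      unfolding Suc rho_def exp_series_basic_set[OF assms(1-3)]
      by (simp only: fps_nth_Abs_fps fps_mult_left_const_nth fps_sub_nth autonomous_linear)
        (simp del: fact_Suc fps_const_mult power_Suc)
  qed
qed

text \<open>Each step absorbs one factor into the accumulator by \<open>star_rho\<close>, so the
  induction needs \<open>g\<close> arbitrary.\<close>

lemma foldl_star_rho:
  assumes "q 1 \<noteq> 0"
  shows "foldl (star q) (rho q (autonomous g)) (map (\<lambda>k. rho q (autonomous (h k))) ks) =
    rho q (autonomous (g * prod_list (map h ks)))"
  using assms by (induction ks arbitrary: g) (simp_all add: star_rho mult.assoc)

theorem theorem3:
  fixes Q :: "'a::field_char_0 poly \<Rightarrow> 'a poly" and q :: "nat \<Rightarrow> 'a poly" and p :: "'a fps"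
    and f :: "'a poly" and a b :: "nat \<Rightarrow> 'a" and n :: nat
    and \<rho> :: "nat \<Rightarrow> 'a qseries"
  assumes "delta_operator Q" and "basic_set Q q" and "Q = pderiv_series p"
    and "n \<ge> 1"
    and "f = (\<Prod>k=1..n. [:b k, a k:])"
    and "coprime f (pderiv f)"
    and "\<And>k. k \<in> {1..n} \<Longrightarrow> a k \<noteq> 0"
    and "\<And>k. k \<in> {1..n} \<Longrightarrow> \<rho> k =
          fps_const [:fps_const (1 / a k) * fps_of_poly [:b k, a k:]:] *
          (exp_series (fps_inv p) (a k) - 1)"
  shows "rho q (autonomous (fps_of_poly f)) = foldl (star q) (\<rho> 1) (map \<rho> [2..<Suc n])"
proof -
  define g where "g = (\<lambda>k. fps_of_poly [:b k, a k:])"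
  \<comment> \<open>A nonzero \<open>q 1\<close> lets the series determine its function, so that
    \<open>star\<close> is well defined.\<close>
  have "degree (q 1) = 1" using assms(2) by (simp add: basic_set_def)
  hence q1: "q 1 \<noteq> 0" by auto
  have \<rho>: "\<rho> k = rho q (autonomous (g k))" if "k \<in> {1..n}" for k
    using rho_autonomous_linear[OF assms(1,3,2)] assms(7,8)[OF that] by (simp add: g_def)
  have "map \<rho> [2..<Suc n] = map (\<lambda>k. rho q (autonomous (g k))) [2..<Suc n]"
    by (intro map_cong refl \<rho>) auto
  moreover have "\<rho> 1 = rho q (autonomous (g 1))" using \<open>n \<ge> 1\<close> by (intro \<rho>) simp
  ultimately have "foldl (star q) (\<rho> 1) (map \<rho> [2..<Suc n]) =
      rho q (autonomous (g 1 * prod_list (map g [2..<Suc n])))"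
    by (simp only: foldl_star_rho[where q = q, OF q1])
  \<comment> \<open>The first factor is the start value of the fold; for \<open>n = 1\<close> the
    list is empty.\<close>
  also have "g 1 * prod_list (map g [2..<Suc n]) = (\<Prod>k=1..n. g k)"
    using \<open>n \<ge> 1\<close> by (simp add: prod.distinct_set_conv_list[symmetric] prod.atLeast_Suc_atMost
      atLeastLessThanSuc_atLeastAtMost numeral_2_eq_2 del: upt_Suc)
  also have "\<dots> = fps_of_poly f"
    by (simp add: assms(5) g_def fps_of_poly_prod)
  finally show ?thesis ..
qed

end
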